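(* There is a tight simplex of $24$ points in $\mathbb{O}\mathbb{P}^2$. In fact, there is such a tight simplex with cyclic symmetry, i.e., one mapped to itself by the isometry of $\mathbb{O}\mathbb{P}^2$ induced by the cyclic shift $\sigma(a,b,c)=(b,c,a)$ (conjugation of projection matrices by the corresponding permutation matrix).
   Context: $\mathbb{O}\mathbb{P}^2$ is the set of $3\times3$ octonionic Hermitian matrices $\Pi$ with $\Pi^2=\Pi$ and $\operatorname{Tr}\Pi=1$ (each of the form $(a,b,c)^t(\bar a,\bar b,\bar c)$), with inner product $\langle A,B\rangle=\operatorname{Re}\operatorname{Tr}(AB)$. A tight simplex of $N$ points in $\mathbb{O}\mathbb{P}^2$ is a set of $N$ distinct points $\Pi_1,\dots,\Pi_N$ with $\langle\Pi_i,\Pi_j\rangle=\frac{N-3}{3(N-1)}$ for all $i\ne j$. *)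

theory Defs
  imports Complex_Main "HOL-Library.Product_Plus" "HOL-Library.Numeral_Type"
begin

text \<open>Octonions via the Cayley-Dickson construction:
  quaternions = pairs of complex numbers, octonions = pairs of quaternions,
  with (a,b)(c,d) = (a c - conj(d) b, d a + b conj(c)) and conj(a,b) = (conj a, -b).\<close>

type_synonym quat = "complex \<times> complex"
type_synonym oct = "quat \<times> quat"

definition qmul :: "quat \<Rightarrow> quat \<Rightarrow> quat" where
  "qmul x y = (fst x * fst y - cnj (snd y) * snd x, snd y * fst x + snd x * cnj (fst y))"

definition qcnj :: "quat \<Rightarrow> quat" where
  "qcnj x = (cnj (fst x), - snd x)"

definition omul :: "oct \<Rightarrow> oct \<Rightarrow> oct" where
  "omul x y = (qmul (fst x) (fst y) - qmul (qcnj (snd y)) (snd x),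
               qmul (snd y) (fst x) + qmul (snd x) (qcnj (fst y)))"

definition ocnj :: "oct \<Rightarrow> oct" where
  "ocnj x = (qcnj (fst x), - snd x)"

definition oone :: oct where
  "oone = ((1, 0), (0, 0))"

definition ore :: "oct \<Rightarrow> real" where
  "ore x = Re (fst (fst x))"

type_synonym omat = "3 \<Rightarrow> 3 \<Rightarrow> oct"

definition mmul :: "omat \<Rightarrow> omat \<Rightarrow> omat" where
  "mmul A B = (\<lambda>i j. \<Sum>k\<in>UNIV. omul (A i k) (B k j))"

definition mtrace :: "omat \<Rightarrow> oct" where
  "mtrace A = (\<Sum>i\<in>UNIV. A i i)"

definition hermitian :: "omat \<Rightarrow> bool" where
  "hermitian A \<longleftrightarrow> (\<forall>i j. A j i = ocnj (A i j))"

definition OP2 :: "omat set" where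
  "OP2 = {P. hermitian P \<and> mmul P P = P \<and> mtrace P = oone}"

definition minner :: "omat \<Rightarrow> omat \<Rightarrow> real" where
  "minner A B = ore (mtrace (mmul A B))"

definition tight_simplex :: "omat set \<Rightarrow> bool" where
  "tight_simplex S \<longleftrightarrow> finite S \<and> S \<subseteq> OP2 \<and>
     (\<forall>A\<in>S. \<forall>B\<in>S. A \<noteq> B \<longrightarrow>
        minner A B = (real (card S) - 3) / (3 * (real (card S) - 1)))"

text \<open>Isometry induced by the cyclic shift sigma(a,b,c) = (b,c,a):
  conjugation by the permutation matrix, (P M P^T)_{ij} = M_{sigma i, sigma j}.\<close>
definition cycshift :: "omat \<Rightarrow> omat" where
  "cycshift M = (\<lambda>i j. M (i + 1) (j + 1))"

end

theory Submission
  imports Defs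
begin

text \<open>
  The simplex is invariant under a group of order 21, generated by the cyclic shift and an octonion
  automorphism of order 7 that scales the complex coordinates of \<open>((a, b), (c, d))\<close> by
  \<open>1, z, z\<^sup>2, z\<^sup>3\<close>. It consists of the shifts of one real point \<open>X0\<close> and of the seven points
  \<open>X z\<close> with \<open>z ^ 7 = 1\<close>. Decomposing a Hermitian matrix into characters of this
  group, the simplex condition for the \<open>X z\<close> says that its nontrivial isotypic components all
  have the same norm: the coordinates \<open>b, c, cnj d\<close> of the three off-diagonal entries, after a
  discrete Fourier transform along the shift, form a \<open>3 \<times> 3\<close> matrix \<open>\<Phi>\<close> of complex numbers of equal
  modulus, and idempotency forces the complex part of the projection to be a multiple of the inverse
  of \<open>\<Phi> \<Phi>\<^sup>*\<close>. Choosing \<open>\<Phi>\<close> so that the latter matrix is real and invariant under exchanging the two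
  nontrivial characters of the shift leaves equations that are solved by iterated square roots.
\<close>

section \<open>Indices modulo three and octonion arithmetic\<close>

lemma UNIV_three: "(UNIV :: 3 set) = {0, 1, 2}"
proof (rule sym, rule card_subset_eq)
  show "card {0, 1, 2 :: 3} = card (UNIV :: 3 set)" by simp
qed auto

lemma sum_UNIV_three: "sum f (UNIV :: 3 set) = f 0 + f 1 + f 2"
  unfolding UNIV_three by (simp add: add.assoc)

lemma all_three: "(\<forall>i :: 3. Q i) \<longleftrightarrow> Q 0 \<and> Q 1 \<and> Q 2"
  by (metis UNIV_I UNIV_three empty_iff insert_iff)

lemma ext_three: "(f :: 3 \<Rightarrow> 'a) = g \<longleftrightarrow> f 0 = g 0 \<and> f 1 = g 1 \<and> f 2 = g 2"
  by (simp add: fun_eq_iff all_three)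

lemma three_eq_zero [simp]: "(3 :: 3) = 0"
  by simp

lemmas oct_defs = omul_def ocnj_def qmul_def qcnj_def

definition oscale :: "real \<Rightarrow> oct \<Rightarrow> oct" where
  "oscale t x = ((of_real t * fst (fst x), of_real t * snd (fst x)),
                 (of_real t * fst (snd x), of_real t * snd (snd x)))"

definition odot :: "oct \<Rightarrow> oct \<Rightarrow> real" where
  "odot x y = Re (fst (fst x) * cnj (fst (fst y)) + snd (fst x) * cnj (snd (fst y))
                + fst (snd x) * cnj (fst (snd y)) + snd (snd x) * cnj (snd (snd y)))"

lemma of_real_odot_self:
  "complex_of_real (odot x x) = fst (fst x) * cnj (fst (fst x)) + snd (fst x) * cnj (snd (fst x))
     + fst (snd x) * cnj (fst (snd x)) + snd (snd x) * cnj (snd (snd x))"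
  by (simp add: odot_def complex_eq_iff)

lemma ore_omul_commute: "ore (omul x y) = ore (omul y x)"
  by (simp add: ore_def oct_defs algebra_simps)

lemma ore_add: "ore (x + y) = ore x + ore y"
  by (simp add: ore_def)

lemma ocnj_ocnj [simp]: "ocnj (ocnj x) = x"
  by (simp add: oct_defs)

lemma ocnj_omul: "ocnj (omul x y) = omul (ocnj y) (ocnj x)"
  by (simp add: oct_defs algebra_simps)

lemma ocnj_oscale: "ocnj (oscale t x) = oscale t (ocnj x)"
  by (simp add: oct_defs oscale_def)

lemma ocnj_oscale_oone [simp]: "ocnj (oscale t oone) = oscale t oone"
  by (simp add: oct_defs oscale_def oone_def)

lemma omul_oscale_left: "omul (oscale t x) y = oscale t (omul x y)"
  and omul_oscale_right: "omul x (oscale t y) = oscale t (omul x y)"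
  by (simp_all add: oct_defs oscale_def algebra_simps)

lemma omul_oone [simp]: "omul oone x = x" "omul x oone = x"
  by (simp_all add: oct_defs oone_def prod_eq_iff)

lemma oscale_oscale: "oscale s (oscale t x) = oscale (s * t) x"
  by (simp add: oscale_def)

lemma oscale_one [simp]: "oscale 1 x = x"
  by (simp add: oscale_def)

lemma oscale_add_left: "oscale s x + oscale t x = oscale (s + t) x"
  by (simp add: oscale_def algebra_simps)

text \<open>Octonions are alternative but not associative; this cancellation and its mirror image
  take the place of associativity in the idempotency computation.\<close>

lemma omul_ocnj_cancel_left: "omul (ocnj x) (omul x y) = oscale (odot x x) y"
  by (simp add: oscale_def of_real_odot_self oct_defs algebra_simps)

lemma omul_ocnj_cancel_right: "omul (omul y x) (ocnj x) = oscale (odot x x) y"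
  by (simp add: oscale_def of_real_odot_self oct_defs algebra_simps)

lemma omul_ocnj_self: "omul x (ocnj x) = oscale (odot x x) oone"
  using omul_ocnj_cancel_right[of oone x] by simp

lemma ocnj_omul_self: "omul (ocnj x) x = oscale (odot x x) oone"
  using omul_ocnj_cancel_left[of x oone] by simp

lemma odot_ocnj: "odot (ocnj x) (ocnj y) = odot x y"
  by (simp add: oct_defs odot_def)

lemma odot_oscale: "odot (oscale s x) (oscale t y) = s * t * odot x y"
  by (simp add: oscale_def odot_def algebra_simps)

lemma ore_omul: "ore (omul x y) = odot x (ocnj y)"
  by (simp add: ore_def odot_def oct_defs algebra_simps)

lemma odot_omul_adjoint: "odot (omul x y) z = odot y (omul (ocnj x) z)"
  by (simp add: odot_def oct_defs algebra_simps)

text \<open>Left multiplication by \<open>ocnj x\<close> is adjoint to that by \<open>x\<close>, and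
  the two cancel up to the norm of \<open>x\<close>.\<close>

lemma odot_omul_self: "odot (omul x y) (omul x y) = odot x x * odot y y"
  using odot_oscale[of 1 y "odot x x" y]
  by (simp add: odot_omul_adjoint omul_ocnj_cancel_left)

section \<open>Hermitian matrices and projections\<close>

text \<open>The off-diagonal entries sit at the cyclic positions (0,1), (1,2), (2,0), so that the
  shift merely rotates the parameters.\<close>

definition hmat :: "real \<Rightarrow> real \<Rightarrow> real \<Rightarrow> oct \<Rightarrow> oct \<Rightarrow> oct \<Rightarrow> omat" where
  "hmat a b c u v w = (\<lambda>i j.
     if i = 0 then (if j = 0 then oscale a oone else if j = 1 then u else ocnj w)
     else if i = 1 then (if j = 0 then ocnj u else if j = 1 then oscale b oone else v)
     else (if j = 0 then w else if j = 1 then ocnj v else oscale c oone))"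

lemma hmat_simps [simp]:
  "hmat a b c u v w 0 0 = oscale a oone" "hmat a b c u v w 0 1 = u" "hmat a b c u v w 0 2 = ocnj w"
  "hmat a b c u v w 1 0 = ocnj u" "hmat a b c u v w 1 1 = oscale b oone" "hmat a b c u v w 1 2 = v"
  "hmat a b c u v w 2 0 = w" "hmat a b c u v w 2 1 = ocnj v" "hmat a b c u v w 2 2 = oscale c oone"
  by (simp_all add: hmat_def)

lemma cycshift_hmat: "cycshift (hmat a b c u v w) = hmat b c a v w u"
  by (simp add: ext_three cycshift_def)

lemma minner_hmat:
  "minner (hmat a b c u v w) (hmat a' b' c' u' v' w') =
     a * a' + b * b' + c * c' + 2 * (odot u u' + odot v v' + odot w w')"
  by (simp add: minner_def mtrace_def mmul_def sum_UNIV_three ore_add ore_omul odot_ocnj)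
     (simp add: odot_oscale, simp add: odot_def oone_def)

text \<open>The first row determines the projection: \<open>wu\<close> forces \<open>v\<close> to be
  \<open>1 / a\<close> times the conjugate of \<open>omul w u\<close>, and the other products of
  entries follow by cancelling conjugates.\<close>

lemma hmat_in_OP2:
  assumes tr: "a + b + c = 1" and a: "a \<noteq> 0"
    and u: "odot u u = a * b" and w: "odot w w = c * a"
    and wu: "ocnj (omul w u) = oscale a v"
  shows "hmat a b c u v w \<in> OP2"
proof -
  have v: "v = oscale (1 / a) (omul (ocnj u) (ocnj w))"
    using wu a by (metis ocnj_omul oscale_oscale oscale_one nonzero_divide_eq_eq)
  have cv: "ocnj v = oscale (1 / a) (omul w u)"
    by (simp add: v ocnj_oscale ocnj_omul)
  have wcv: "omul (ocnj w) (ocnj v) = oscale c u"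
    using a by (simp add: cv omul_oscale_right omul_ocnj_cancel_left w oscale_oscale)
  have cvu: "omul (ocnj v) (ocnj u) = oscale b w"
    using a by (simp add: cv omul_oscale_left omul_ocnj_cancel_right u oscale_oscale)
  have vw: "omul v w = oscale c (ocnj u)" and uv: "omul u v = oscale b (ocnj w)"
    using arg_cong[OF wcv, of ocnj] arg_cong[OF cvu, of ocnj]
    by (simp_all add: ocnj_omul ocnj_oscale)
  have vv: "odot v v = b * c"
    using a by (simp add: v odot_oscale odot_omul_self odot_ocnj u w)
  have wu': "omul w u = oscale a (ocnj v)" and uw: "omul (ocnj u) (ocnj w) = oscale a v"
    using a by (simp add: cv oscale_oscale, simp add: v oscale_oscale)
  have herm: "hermitian (hmat a b c u v w)"
    by (simp add: hermitian_def all_three)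
  have a_eq: "a = 1 - b - c" using tr by simp
  have idem: "mmul (hmat a b c u v w) (hmat a b c u v w) = hmat a b c u v w"
    by (simp add: ext_three mmul_def sum_UNIV_three omul_oscale_left omul_oscale_right
        omul_ocnj_self ocnj_omul_self u w vv vw uv wcv cvu wu' uw oscale_oscale oscale_add_left,
        simp add: a_eq algebra_simps)
  have "mtrace (hmat a b c u v w) = oone"
    using tr by (simp add: mtrace_def sum_UNIV_three oscale_add_left)
  with herm idem show ?thesis
    by (simp add: OP2_def)
qed

section \<open>Orbits of the cyclic shift\<close>

lemma minner_commute: "minner A B = minner B A"
proof -
  have eq: "minner A B = (\<Sum>i\<in>UNIV. \<Sum>k\<in>UNIV. ore (omul (A i k) (B k i)))" for A B
    by (simp add: minner_def mtrace_def mmul_def sum_UNIV_three ore_add)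
  show ?thesis
    unfolding eq by (subst sum.swap) (intro sum.cong refl ore_omul_commute)
qed

lemma minner_cycshift: "minner (cycshift A) (cycshift B) = minner A B"
  by (simp add: minner_def mtrace_def mmul_def sum_UNIV_three cycshift_def ore_add)

lemma cycshift_cubed [simp]: "cycshift (cycshift (cycshift A)) = A"
  by (simp add: ext_three cycshift_def)

lemma cycshift_in_OP2:
  assumes "A \<in> OP2"
  shows "cycshift A \<in> OP2"
proof -
  have "mmul (cycshift A) (cycshift A) = cycshift (mmul A A)"
    by (simp add: ext_three mmul_def sum_UNIV_three cycshift_def add_ac)
  moreover have "mtrace (cycshift A) = mtrace A"
    by (simp add: mtrace_def sum_UNIV_three cycshift_def add_ac)
  moreover have "hermitian (cycshift A)"
    using assms unfolding OP2_def hermitian_def cycshift_def by blast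
  ultimately show ?thesis
    using assms by (simp add: OP2_def)
qed

lemma minner_self: "A \<in> OP2 \<Longrightarrow> minner A A = 1"
  by (simp add: OP2_def minner_def ore_def oone_def)

text \<open>The required inner product for 24 points is 21/69 = 7/23. As it differs from 1, the
  value of \<open>minner A A\<close>, the three shifts of \<open>B\<close> are disjoint; invariance
  reduces the double shift to the single one.\<close>

lemma cyclic_tight_simplex:
  assumes sub: "B \<subseteq> OP2" and card: "card B = 8"
    and shift: "\<And>A C. A \<in> B \<Longrightarrow> C \<in> B \<Longrightarrow> minner A (cycshift C) = 7 / 23"
    and diff: "\<And>A C. A \<in> B \<Longrightarrow> C \<in> B \<Longrightarrow> A \<noteq> C \<Longrightarrow> minner A C = 7 / 23"
  shows "\<exists>S. tight_simplex S \<and> card S = 24 \<and> (\<forall>P\<in>S. cycshift P \<in> S)"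
proof -
  let ?T = cycshift
  let ?S = "B \<union> ?T ` B \<union> ?T ` ?T ` B"
  have inj: "inj_on ?T X" for X
    by (metis inj_onI cycshift_cubed)
  have fin: "finite B" using card by (metis card.infinite zero_neq_numeral)
  have shift': "minner A (?T (?T C)) = 7 / 23" if "A \<in> B" "C \<in> B" for A C
    using shift[OF that(2,1)] minner_cycshift[of A "?T (?T C)"] minner_commute by simp
  have one: "minner A A = 1" if "A \<in> B" for A
    using that sub minner_self by blast
  have disj: "B \<inter> ?T ` B = {}" "B \<inter> ?T ` ?T ` B = {}"
    using one shift shift' by fastforce+
  have "?T ` B \<inter> ?T ` ?T ` B = {}"
    using disj(1) inj by (metis image_Int image_empty)
  with disj(2) have "(B \<union> ?T ` B) \<inter> ?T ` ?T ` B = {}"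
    by blast
  then have "card ?S = card B + card (?T ` B) + card (?T ` ?T ` B)"
    using fin disj(1) by (simp add: card_Un_disjoint)
  then have cS: "card ?S = 24"
    using card by (simp add: card_image inj)
  have closed: "?T P \<in> ?S" if "P \<in> ?S" for P
    using that by force
  define good where "good A \<longleftrightarrow> (\<forall>C\<in>?S. A \<noteq> C \<longrightarrow> minner A C = 7 / 23)" for A
  have base: "good A" if "A \<in> B" for A
    using that diff shift shift' unfolding good_def by blast
  have step: "good (?T A)" if "good A" for A
    unfolding good_def
  proof (intro ballI impI)
    fix C assume C: "C \<in> ?S" "?T A \<noteq> C"
    then have "A \<noteq> ?T (?T C)"
      by auto
    then have "minner A (?T (?T C)) = 7 / 23"
      using that closed[OF closed[OF C(1)]] unfolding good_def by blast
    then show "minner (?T A) C = 7 / 23"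
      using minner_cycshift[of A "?T (?T C)"] by simp
  qed
  have good: "good A" if "A \<in> ?S" for A
    using that by (elim UnE imageE) (simp_all add: base step)
  have "?S \<subseteq> OP2"
    using sub cycshift_in_OP2 by blast
  then have "tight_simplex ?S"
    using good fin unfolding tight_simplex_def cS good_def by simp
  with cS closed show ?thesis
    by blast
qed

section \<open>The octonion automorphism and seventh roots of unity\<close>

text \<open>For unimodular \<open>z\<close> this is an octonion automorphism: the weights satisfy 1
  + 2 = 3, as the Cayley-Dickson products require.\<close>

definition twist :: "complex \<Rightarrow> oct \<Rightarrow> oct" where
  "twist z x = ((fst (fst x), z * snd (fst x)), (z ^ 2 * fst (snd x), z ^ 3 * snd (snd x)))"

lemma twist_omul:
  assumes "z * cnj z = 1"
  shows "omul (twist z x) (twist z y) = twist z (omul x y)"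
proof -
  have "z * (cnj z * t) = t" for t
    using assms by (simp flip: mult.assoc)
  moreover from this have "cnj z * (z * t) = t" for t
    by (simp add: mult.left_commute)
  ultimately have cancel: "z * (cnj z * t) = t \<and> cnj z * (z * t) = t" for t
    by blast
  show ?thesis
    by (simp add: cancel twist_def oct_defs power2_eq_square power3_eq_cube algebra_simps)
qed

lemma ocnj_twist: "ocnj (twist z x) = twist z (ocnj x)"
  by (simp add: twist_def oct_defs)

lemma oscale_twist: "oscale t (twist z x) = twist z (oscale t x)"
  by (simp add: twist_def oscale_def)

lemma seventh_root_of_unity:
  fixes z :: complex
  assumes "z ^ 7 = 1"
  shows "z * cnj z = 1"
proof -
  have "norm z ^ 7 = 1" using assms by (metis norm_one norm_power)
  then have "norm z = 1" using power_eq_imp_eq_base[of "norm z" 7 1] by simp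
  then show ?thesis by (simp flip: complex_norm_square)
qed

text \<open>The exponents 1, 2, 4 are the quadratic residues modulo 7. Conjugation sends this period
  to the one over 3, 5, 6, and together they sum to -1.\<close>

lemma Re_gauss_period:
  fixes z :: complex
  assumes z: "z ^ 7 = 1" "z \<noteq> 1"
  shows "Re (z + z ^ 2 + z ^ 4) = - 1 / 2"
proof -
  have zc: "z * cnj z = 1" using z(1) by (rule seventh_root_of_unity)
  have "z ^ 7 = z ^ 6 * z"
    using power_add[of z 6 1] by simp
  then have "cnj z = z ^ 6 * (z * cnj z)"
    using z(1) by (simp flip: mult.assoc)
  then have c: "cnj z = z ^ 6"
    using zc by simp
  have "z ^ 12 = z ^ 7 * z ^ 5" "z ^ 24 = (z ^ 7) ^ 3 * z ^ 3"
    using power_add[of z 7 5] power_mult[of z 7 3] power_add[of z 21 3] by simp_all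
  then have pw: "z ^ 12 = z ^ 5" "z ^ 24 = z ^ 3"
    using z(1) by simp_all
  have "(z - 1) * (1 + z + z ^ 2 + z ^ 3 + z ^ 4 + z ^ 5 + z ^ 6) = z ^ 7 - 1"
    by (simp add: algebra_simps eval_nat_numeral)
  then have "1 + z + z ^ 2 + z ^ 3 + z ^ 4 + z ^ 5 + z ^ 6 = 0"
    using z by simp
  moreover have "cnj (z + z ^ 2 + z ^ 4) = z ^ 6 + z ^ 5 + z ^ 3"
    using c pw power_mult[of z 6 2] power_mult[of z 6 4] by simp
  moreover have "z + z ^ 2 + z ^ 4 + (z ^ 6 + z ^ 5 + z ^ 3)
      = (1 + z + z ^ 2 + z ^ 3 + z ^ 4 + z ^ 5 + z ^ 6) - 1"
    by simp
  ultimately have "(z + z ^ 2 + z ^ 4) + cnj (z + z ^ 2 + z ^ 4) = - 1"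
    by (metis diff_0)
  then have "complex_of_real (2 * Re (z + z ^ 2 + z ^ 4)) = complex_of_real (- 1)"
    by (subst (asm) complex_add_cnj) simp
  then show ?thesis
    unfolding of_real_eq_iff by simp
qed

section \<open>Solving for the parameters\<close>

text \<open>
  In the Fourier frame of the shift, the complex part of the projection is
  \<open>[[m, n, n], [n, m', n'], [n, n', m']]\<close> and \<open>\<Phi>\<close> is, up to column phases,
  \<open>[[e, E, E], [1, \<epsilon>, cnj \<epsilon>], [1, cnj \<epsilon>, \<epsilon>]]\<close> with \<open>\<epsilon> = g + i H / sqrt 3\<close>,
  \<open>E = E1 + i E2\<close> and \<open>e = \<eta> - 2 g E\<close>. The off-diagonal entries of \<open>\<Phi> \<Phi>\<^sup>*\<close> are \<open>\<eta>\<close> (twice) and \<open>k\<close>.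
\<close>

lemma real_parameters:
  obtains p q u v x y s g H m n \<eta> k L E1 E2 :: real where
    "p > 0" "H > 0" "p + 2 * q = 1" "s * s = 16 / 1449"
    "4 * (g * g) = 1 + k" "4 * (H * H) = 3 * (3 - k)" "E1 * E1 + E2 * E2 = 1" "4 * (g * E1) = L"
    "m * (p + 2 * u) * \<eta> + 2 * m * (p - u) + n * (p + 2 * u) * (1 + k) = 6 * (s * s) * (3 - k)"
    "- 2 * m * (p + 2 * u) + 2 * n * (p + 2 * u) * \<eta> + 4 * n * (p - u) - 2 * n * (p + 2 * u) * L
       = - 6 * (s * s) * (3 - k)"
    "p + 2 * u = - (m * (\<eta> - 1) + n * (1 + k))"
    "p - u = m - n * (\<eta> - 1) + n * L"
    "m * m + m * n * L + n * n * (1 + k) = 3 * (s * s) * (3 - k)"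
    "\<eta> * \<eta> - \<eta> * L + k = 0"
    "p * v = u * u + 2 * (s * s) * (\<eta> - k)"
    "p * q = u * u + s * s * (9 - 2 * \<eta> - k)"
    "p * p + 2 * (q * q) + 4 * (u * u) + 2 * (v * v) = 65 / 161"
    "2 * p * q + q * q + 2 * (2 * u * v + u * u) = 7 / 23"
    "x * x + 2 * (y * y) = 1" "(2 * (x * y) + y * y)\<^sup>2 = 7 / 23"
    "p * (x * x) + 2 * q * (y * y) + 4 * u * (x * y) + 2 * v * (y * y) = 7 / 23"
    "q * (x * x) + (p + q) * (y * y) + 2 * ((u + v) * (x * y) + u * (y * y)) = 7 / 23"
proof -
  \<comment> \<open>The solution lies in the field generated by \<open>r\<close>, \<open>P\<close>,
    \<open>Q\<close>, apart from the further roots in \<open>g\<close>, \<open>H\<close>,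
    \<open>E1\<close>, \<open>E2\<close>, \<open>x\<close>, \<open>y\<close>. The decimal bounds
    serve the inequalities only.\<close>
  define r where "r = sqrt 161"
  have r: "r * r = 161" and r1: "12.68 < r" and r2: "r < 12.69"
    unfolding r_def by (simp, rule real_less_rsqrt, simp add: power2_eq_square,
        rule real_less_lsqrt, simp_all add: power2_eq_square)
  define P where "P = sqrt (15 - r)"
  have P: "P * P = 15 - r" and P0: "0 < P"
    using r2 by (simp_all add: P_def)
  have P2: "P < 1.53"
    unfolding P_def by (rule real_less_lsqrt) (use r1 in \<open>simp_all add: power2_eq_square\<close>)
  define Q where "Q = sqrt (18 + 2 * r)"
  have Q: "Q * Q = 18 + 2 * r"
    using r1 by (simp add: Q_def)
  have Q1: "6.58 < Q"
    unfolding Q_def by (rule real_less_rsqrt) (use r1 in \<open>simp add: power2_eq_square\<close>)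
  have Q2: "Q < 6.59"
    unfolding Q_def by (rule real_less_lsqrt) (use r2 in \<open>simp_all add: power2_eq_square\<close>)
  have R: "r * (r * t) = 161 * t" "P * (P * t) = (15 - r) * t" "Q * (Q * t) = (18 + 2 * r) * t" for t
    by (simp_all add: r P Q flip: mult.assoc)
  define n where "n = P * r / 483"
  define m where "m = (161 - 2 * r) / 483"
  define s where "s = 4 * r / 483"
  define \<eta> where "\<eta> = - P * (Q + r + 1) / 48"
  define k where "k = (15 - r + Q * (r - 2)) / 48"
  define L where "L = P * (131 + 5 * r - 49 * Q - 3 * r * Q) / 192"
  define p where "p = (483 + 4 * P * r - 2 * Q * r) / 1449"
  define q where "q = (483 - 2 * P * r + Q * r) / 1449"
  define u where "u = r * (P + Q - 3) / 1449"
  define v where "v = - r * (3 + 2 * P + 2 * Q) / 1449"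
  define T where "T = (7 * r + 161) / 46368"
  note D = n_def m_def \<eta>_def k_def L_def p_def q_def u_def v_def T_def
  note ring = R r P Q algebra_simps add_divide_distrib diff_divide_distrib power2_eq_square
  have ss: "s * s = 16 / 1449"
    by (simp add: s_def ring)
  have "Q * r < 6.59 * 12.69"
    using r1 r2 Q1 Q2 by (intro mult_strict_mono) auto
  moreover have "6.58 * 12.68 < Q * r"
    using r1 r2 Q1 Q2 by (intro mult_strict_mono) auto
  ultimately have Qr: "83.43 < Q * r" "Q * r < 83.63"
    by simp_all
  have "0 < P * r" using P0 r1 by simp
  then have p0: "p > 0"
    using Qr by (simp add: p_def)
  have k1: "1.45 < k" and k2: "k < 3"
    using Qr Q1 Q2 r1 r2 by (simp_all add: k_def algebra_simps)
  \<comment> \<open>Since \<open>E1 = L / (4 * g)\<close>, this bounds \<open>E1\<close> by 1 in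
    absolute value, so that \<open>E2\<close> can be a real square root.\<close>
  have Lsq: "L * L < 4 * (1 + k)"
  proof -
    define J where "J = - (131 + 5 * r - 49 * Q - 3 * r * Q)"
    have J: "0 < J" "J < 381" using Qr Q1 Q2 r1 r2 by (simp_all add: J_def algebra_simps)
    have "P * J < 1.53 * 381"
      using J P0 P2 by (intro mult_strict_mono) auto
    then have "P * J / 192 < 3.04" "0 < P * J / 192" using P0 J by simp_all
    then have "(P * J / 192) * (P * J / 192) < 3.04 * 3.04"
      by (intro mult_strict_mono) auto
    moreover have "L = - (P * J / 192)"
      by (simp add: L_def J_def ring)
    ultimately show ?thesis using k1 by simp
  qed
  define g where "g = sqrt (1 + k) / 2"
  have g: "4 * (g * g) = 1 + k" and g0: "g > 0" using k1 by (simp_all add: g_def)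
  define H where "H = sqrt (3 * (3 - k)) / 2"
  have H: "4 * (H * H) = 3 * (3 - k)" and H0: "H > 0" using k2 by (simp_all add: H_def)
  define E1 where "E1 = L / (4 * g)"
  have E1: "4 * (g * E1) = L" using g0 by (simp add: E1_def)
  have "E1 * E1 = L * L / (4 * (1 + k))"
    by (simp add: E1_def flip: g)
  also have "\<dots> \<le> 1" using Lsq k1 by simp
  finally have E1': "E1 * E1 \<le> 1" .
  define E2 where "E2 = sqrt (1 - E1 * E1)"
  have E: "E1 * E1 + E2 * E2 = 1" using E1' by (simp add: E2_def)
  \<comment> \<open>\<open>1 / T = 414 - 18 * r\<close> is the squared length of
    \<open>(Q + 4 * P, Q - 2 * P, Q - 2 * P)\<close>, so \<open>(x, y, y)\<close> is a unit
    vector.\<close>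
  define x where "x = sqrt T * (Q + 4 * P)"
  define y where "y = sqrt T * (Q - 2 * P)"
  have "T > 0" using r1 by (simp add: T_def)
  then have xy: "x * x = T * ((Q + 4 * P) * (Q + 4 * P))" "y * y = T * ((Q - 2 * P) * (Q - 2 * P))"
    "x * y = T * ((Q + 4 * P) * (Q - 2 * P))"
    by (simp_all add: x_def y_def)
  show thesis
    by (rule that[of p H q s g k E1 E2 L m u \<eta> n v x y])
       (fact p0 H0 ss g H E E1 | simp only: ss xy D, simp add: ring)+
qed

text \<open>
  The point \<open>X0\<close> is the real projection onto \<open>(x, y, y)\<close>. The matrix \<open>X z\<close> with \<open>z = 1\<close> has diagonal \<open>(p, q, q)\<close> and
  entries \<open>((u, K), (A, cnj B))\<close>, \<open>((v, N), (C, cnj C))\<close>, \<open>((u, K), (B, cnj A))\<close> in the positions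
  \<open>(0, 1)\<close>, \<open>(1, 2)\<close>, \<open>(2, 0)\<close>; the last four equations express that it is idempotent.
\<close>

lemma generating_data:
  obtains p q u v x y :: real and A B C K N :: complex where
    "p > 0" "p + 2 * q = 1"
    "p * p + 2 * (q * q) + 4 * (u * u) + 2 * (v * v) = 65 / 161"
    "2 * p * q + q * q + 2 * (2 * u * v + u * u) = 7 / 23"
    "x * x + 2 * (y * y) = 1" "(2 * (x * y) + y * y)\<^sup>2 = 7 / 23"
    "p * (x * x) + 2 * q * (y * y) + 4 * u * (x * y) + 2 * v * (y * y) = 7 / 23"
    "q * (x * x) + (p + q) * (y * y) + 2 * ((u + v) * (x * y) + u * (y * y)) = 7 / 23"
    "2 * (K * cnj K) + N * cnj N = 16 / 161" "K * cnj N + N * cnj K + K * cnj K = 0"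
    "A * cnj A + B * cnj B + C * cnj C = 16 / 161" "A * cnj C + C * cnj B + B * cnj A = 0"
    "of_real u * of_real u + K * cnj K + A * cnj A + B * cnj B = of_real p * of_real q"
    "of_real p * of_real v = of_real u * of_real u - (K * cnj K + A * cnj B + B * cnj A)"
    "of_real p * N = - (2 * of_real u * K + cnj (B * B - A * A))"
    "of_real p * C = - (of_real u * (A + B) + cnj (K * (A - B)))"
proof -
  obtain p q u v x y s g H m n \<eta> k L E1 E2 :: real where
    par: "p > 0" "p + 2 * q = 1"
    "p * p + 2 * (q * q) + 4 * (u * u) + 2 * (v * v) = 65 / 161"
    "2 * p * q + q * q + 2 * (2 * u * v + u * u) = 7 / 23"
    "x * x + 2 * (y * y) = 1" "(2 * (x * y) + y * y)\<^sup>2 = 7 / 23"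
    "p * (x * x) + 2 * q * (y * y) + 4 * u * (x * y) + 2 * v * (y * y) = 7 / 23"
    "q * (x * x) + (p + q) * (y * y) + 2 * ((u + v) * (x * y) + u * (y * y)) = 7 / 23"
    and H0: "H > 0" and ss: "s * s = 16 / 1449"
    and gg: "4 * (g * g) = 1 + k" and HH: "4 * (H * H) = 3 * (3 - k)"
    and EE: "E1 * E1 + E2 * E2 = 1" and gE: "4 * (g * E1) = L"
    and c1: "m * (p + 2 * u) * \<eta> + 2 * m * (p - u) + n * (p + 2 * u) * (1 + k) = 6 * (s * s) * (3 - k)"
    and c2: "- 2 * m * (p + 2 * u) + 2 * n * (p + 2 * u) * \<eta> + 4 * n * (p - u) - 2 * n * (p + 2 * u) * L
       = - 6 * (s * s) * (3 - k)"
    and c3: "p + 2 * u = - (m * (\<eta> - 1) + n * (1 + k))"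
    and c4: "p - u = m - n * (\<eta> - 1) + n * L"
    and c5: "m * m + m * n * L + n * n * (1 + k) = 3 * (s * s) * (3 - k)"
    and c6: "\<eta> * \<eta> - \<eta> * L + k = 0"
    and c7: "p * v = u * u + 2 * (s * s) * (\<eta> - k)"
    and c8: "p * q = u * u + s * s * (9 - 2 * \<eta> - k)"
    by (rule real_parameters)
  \<comment> \<open>Conjugates get their own names \<open>F\<close>, \<open>e'\<close>,
    \<open>W'\<close>, \<open>\<kappa>'\<close>, so that \<open>algebra\<close> can treat them as
    further unknowns with relations such as \<open>E * F = 1\<close>.\<close>
  define E where "E = Complex E1 E2"
  define F where "F = cnj E"
  have EF: "E * F = 1"
    using EE by (simp add: E_def F_def complex_eq_iff)
  have gEF: "2 * of_real g * (E + F) = (of_real L :: complex)"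
    using gE by (simp add: E_def F_def complex_eq_iff)
  define e where "e = of_real \<eta> - 2 * of_real g * E"
  define e' where "e' = of_real \<eta> - 2 * of_real g * F"
  define W where "W = of_real m * F + 2 * of_real n * of_real g"
  define W' where "W' = of_real m * E + 2 * of_real n * of_real g"
  \<comment> \<open>The phase of the first column of \<open>\<Phi>\<close>; it is unimodular because
    \<open>c5\<close> makes the modulus of \<open>W\<close> equal to
    \<open>2 * s * H\<close>.\<close>
  define \<kappa> where "\<kappa> = W / (2 * of_real s * of_real H)"
  define \<kappa>' where "\<kappa>' = W' / (2 * of_real s * of_real H)"
  have cnjs: "cnj E = F" "cnj F = E" "cnj e = e'" "cnj e' = e" "cnj W = W'" "cnj \<kappa> = \<kappa>'"
    by (simp_all add: F_def e_def e'_def W_def W'_def \<kappa>_def \<kappa>'_def)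
  \<comment> \<open>Up to the factor \<open>s\<close>, \<open>C\<close>, \<open>A\<close>,
    \<open>B\<close> form the inverse Fourier transform of the column
    \<open>(E, \<epsilon>, cnj \<epsilon>)\<close>, and \<open>N\<close>, \<open>K\<close>,
    \<open>K\<close> that of \<open>\<kappa>\<close> times \<open>(e, 1, 1)\<close>.\<close>
  define A where "A = of_real s * (E - of_real g + of_real H)"
  define B where "B = of_real s * (E - of_real g - of_real H)"
  define C where "C = of_real s * (E + 2 * of_real g)"
  define K where "K = of_real s * \<kappa> * (e - 1)"
  define N where "N = of_real s * \<kappa> * (e + 2)"
  have cA: "cnj A = of_real s * (F - of_real g + of_real H)"
    and cB: "cnj B = of_real s * (F - of_real g - of_real H)"
    and cC: "cnj C = of_real s * (F + 2 * of_real g)"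
    and cK: "cnj K = of_real s * \<kappa>' * (e' - 1)"
    and cN: "cnj N = of_real s * \<kappa>' * (e' + 2)"
    by (simp_all add: A_def B_def C_def K_def N_def cnjs)
  define cx where "cx = complex_of_real"
  have sS: "cx s * cx s = 16 / 1449"
    using arg_cong[OF ss, of cx] by (simp add: cx_def)
  have gG: "4 * (cx g * cx g) = 1 + cx k"
    using arg_cong[OF gg, of cx] by (simp add: cx_def)
  have hH: "4 * (cx H * cx H) = 3 * (3 - cx k)"
    using arg_cong[OF HH, of cx] by (simp add: cx_def)
  note C1 = arg_cong[OF c1, of cx, unfolded ss, unfolded cx_def, simplified, folded cx_def]
  note C2 = arg_cong[OF c2, of cx, unfolded ss, unfolded cx_def, simplified, folded cx_def]
  note C3 = arg_cong[OF c3, of cx, unfolded cx_def, simplified, folded cx_def]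
  note C4 = arg_cong[OF c4, of cx, unfolded cx_def, simplified, folded cx_def]
  note C5 = arg_cong[OF c5, of cx, unfolded ss, unfolded cx_def, simplified, folded cx_def]
  note C6 = arg_cong[OF c6, of cx, unfolded cx_def, simplified, folded cx_def]
  note C7 = arg_cong[OF c7, of cx, unfolded ss, unfolded cx_def, simplified, folded cx_def]
  note C8 = arg_cong[OF c8, of cx, unfolded ss, unfolded cx_def, simplified, folded cx_def]
  note gEF = gEF[folded cx_def]
  have s0: "cx s \<noteq> 0" using sS by auto
  have H0': "cx H \<noteq> 0" using H0 by (simp add: cx_def)
  have ee: "e * e' = 1"
    unfolding e_def e'_def cx_def[symmetric] using EF gEF C6 gG by algebra
  have es: "e + e' = 2 * cx \<eta> - cx L"
    unfolding e_def e'_def cx_def[symmetric] gEF[symmetric] by (simp add: algebra_simps)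
  have "W * W' = 4 * (cx s * cx s) * (cx H * cx H)"
    unfolding W_def W'_def cx_def[symmetric] using EF gEF C5 gG hH sS by algebra
  then have kk: "\<kappa> * \<kappa>' = 1"
    unfolding \<kappa>_def \<kappa>'_def cx_def[symmetric] using s0 H0' by (simp add: field_simps)
  have kW: "2 * cx s * cx H * \<kappa> = W" "2 * cx s * cx H * \<kappa>' = W'"
    unfolding \<kappa>_def \<kappa>'_def cx_def[symmetric] using s0 H0' by simp_all
  have KK: "K * cnj K = 16 / 1449 * (2 - 2 * cx \<eta> + cx L)"
    unfolding cK unfolding K_def cx_def[symmetric] using kk ee es sS by algebra
  have NN: "N * cnj N = 16 / 1449 * (5 + 4 * cx \<eta> - 2 * cx L)"
    unfolding cN unfolding N_def cx_def[symmetric] using kk ee es sS by algebra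
  have r1: "2 * (K * cnj K) + N * cnj N = 16 / 161"
    using KK NN by algebra
  have "K * cnj N + N * cnj K = 16 / 1449 * (- 2 + 2 * cx \<eta> - cx L)"
    unfolding cN cK unfolding N_def K_def cx_def[symmetric] using kk ee es sS by algebra
  then have r2: "K * cnj N + N * cnj K + K * cnj K = 0"
    using KK by algebra
  have r3: "A * cnj A + B * cnj B + C * cnj C = 16 / 161"
    unfolding cA cB cC unfolding A_def B_def C_def cx_def[symmetric] using EF gG hH sS by algebra
  have r4: "A * cnj C + C * cnj B + B * cnj A = 0"
    unfolding cA cB cC unfolding A_def B_def C_def cx_def[symmetric] using EF gG hH sS by algebra
  have "A * cnj A + B * cnj B = 16 / 1449 * (7 - cx L - cx k)"
    unfolding cA cB unfolding A_def B_def cx_def[symmetric] using EF gEF gG hH sS by algebra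
  then have r5: "cx u * cx u + K * cnj K + A * cnj A + B * cnj B = cx p * cx q"
    using C8 KK by algebra
  have "A * cnj B + B * cnj A = 16 / 1449 * (2 * cx k - 2 - cx L)"
    unfolding cA cB unfolding A_def B_def cx_def[symmetric] using EF gEF gG hH sS by algebra
  then have r6: "cx p * cx v = cx u * cx u - (K * cnj K + A * cnj B + B * cnj A)"
    using C7 KK by algebra
  \<comment> \<open>Eliminating \<open>E\<close> through \<open>2 * g * (E + F) = L\<close> and
    comparing the coefficients of \<open>F\<close> and \<open>g\<close> gives exactly
    \<open>C1\<close> and \<open>C2\<close>.\<close>
  have "W * ((cx p + 2 * cx u) * e + 2 * (cx p - cx u)) = 8 * (cx s * cx s) * (cx H * cx H) * (F - cx g)"
    unfolding W_def e_def cx_def[symmetric] using EF gEF gG hH sS C1 C2 by algebra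
  then have "2 * cx s * cx H * (\<kappa> * ((cx p + 2 * cx u) * e + 2 * (cx p - cx u)))
      = 2 * cx s * cx H * (4 * cx s * cx H * (F - cx g))"
    unfolding kW(1)[symmetric] by (simp add: algebra_simps)
  then have k1: "\<kappa> * ((cx p + 2 * cx u) * e + 2 * (cx p - cx u)) = 4 * cx s * cx H * (F - cx g)"
    using s0 H0' by simp
  have "cnj (B * B - A * A) = - 4 * cx s * cx s * cx H * (F - cx g)"
    by (simp add: cA cB flip: cx_def) (simp add: algebra_simps)
  then have r7: "cx p * N = - (2 * cx u * K + cnj (B * B - A * A))"
    unfolding N_def K_def cx_def[symmetric] using k1 by algebra
  \<comment> \<open>Here \<open>F\<close> is eliminated instead, and the coefficients of
    \<open>E\<close> and \<open>g\<close> give \<open>C3\<close> and \<open>C4\<close>.\<close>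
  have "(cx p + 2 * cx u) * E + 2 * cx g * (cx p - cx u) = - W' * (e' - 1)"
    unfolding W'_def e'_def cx_def[symmetric] using EF gEF gG C3 C4 by algebra
  then have k2: "(cx p + 2 * cx u) * E + 2 * cx g * (cx p - cx u) = - 2 * cx s * cx H * \<kappa>' * (e' - 1)"
    unfolding kW(2)[symmetric] by simp
  have "cnj (K * (A - B)) = 2 * cx s * cx s * cx H * \<kappa>' * (e' - 1)"
    by (simp add: cA cB cK flip: cx_def) (simp add: algebra_simps)
  then have r8: "cx p * C = - (cx u * (A + B) + cnj (K * (A - B)))"
    unfolding C_def A_def B_def cx_def[symmetric] using k2 by algebra
  show thesis
    using that[OF par r1 r2 r3 r4 r5[unfolded cx_def] r6[unfolded cx_def] r7[unfolded cx_def]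
        r8[unfolded cx_def]] .
qed

section \<open>Inner products in the orbit and assembly of the simplex\<close>

text \<open>Only the ratio \<open>z * cnj z'\<close> enters, so inner products between twisted
  points become real parts of cubic polynomials in one variable.\<close>

lemma odot_twist:
  "odot (twist z a) (twist z' b) = Re (fst (fst a) * cnj (fst (fst b))
     + (z * cnj z') * (snd (fst a) * cnj (snd (fst b)))
     + (z * cnj z') ^ 2 * (fst (snd a) * cnj (fst (snd b)))
     + (z * cnj z') ^ 3 * (snd (snd a) * cnj (snd (snd b))))"
proof -
  have "odot (twist z a) (twist z' b) = Re (fst (fst a) * cnj (fst (fst b))
     + (z * snd (fst a)) * cnj (z' * snd (fst b))
     + (z ^ 2 * fst (snd a)) * cnj (z' ^ 2 * fst (snd b))
     + (z ^ 3 * snd (snd a)) * cnj (z' ^ 3 * snd (snd b)))"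
    by (simp only: odot_def twist_def fst_conv snd_conv)
  then show ?thesis
    by (simp only: complex_cnj_mult complex_cnj_power power_mult_distrib ac_simps)
qed

lemma odot_twist_same:
  assumes "z * cnj z = 1"
  shows "odot (twist z a) (twist z b) = odot a b"
  unfolding odot_twist assms unfolding odot_def by simp

lemma odot_real_twist:
  "odot (oscale c oone) (twist z a) = c * Re (fst (fst a))"
  "odot (twist z a) (oscale c oone) = c * Re (fst (fst a))"
  by (simp_all add: odot_def oscale_def oone_def twist_def)

theorem theorem5p4:
  shows "\<exists>S. tight_simplex S \<and> card S = 24 \<and> (\<forall>P\<in>S. cycshift P \<in> S)"
proof -
  obtain p q u v x y :: real and A B C K N :: complex where
    p: "p > 0" and tr: "p + 2 * q = 1"
    and f1: "p * p + 2 * (q * q) + 4 * (u * u) + 2 * (v * v) = 65 / 161"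
    and f2: "2 * p * q + q * q + 2 * (2 * u * v + u * u) = 7 / 23"
    and f3: "x * x + 2 * (y * y) = 1" and f4: "(2 * (x * y) + y * y)\<^sup>2 = 7 / 23"
    and f5: "p * (x * x) + 2 * q * (y * y) + 4 * u * (x * y) + 2 * v * (y * y) = 7 / 23"
    and f6: "q * (x * x) + (p + q) * (y * y) + 2 * ((u + v) * (x * y) + u * (y * y)) = 7 / 23"
    and r1: "2 * (K * cnj K) + N * cnj N = 16 / 161"
    and r2: "K * cnj N + N * cnj K + K * cnj K = 0"
    and r3: "A * cnj A + B * cnj B + C * cnj C = 16 / 161"
    and r4: "A * cnj C + C * cnj B + B * cnj A = 0"
    and r5: "of_real u * of_real u + K * cnj K + A * cnj A + B * cnj B = of_real p * of_real q"
    and r6: "of_real p * of_real v = of_real u * of_real u - (K * cnj K + A * cnj B + B * cnj A)"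
    and r7: "of_real p * N = - (2 * of_real u * K + cnj (B * B - A * A))"
    and r8: "of_real p * C = - (of_real u * (A + B) + cnj (K * (A - B)))"
    by (rule generating_data)
  define U V W :: oct where "U = ((of_real u, K), (A, cnj B))"
    and "V = ((of_real v, N), (C, cnj C))" and "W = ((of_real u, K), (B, cnj A))"
  note UVW = U_def V_def W_def
  define X where "X z = hmat p q q (twist z U) (twist z V) (twist z W)" for z
  define X0 where "X0 = hmat (x * x) (y * y) (y * y)
     (oscale (x * y) oone) (oscale (y * y) oone) (oscale (x * y) oone)"
  define Z where "Z = {z :: complex. z ^ 7 = 1}"
  have Z: "z * cnj z = 1" if "z \<in> Z" for z
    using that seventh_root_of_unity by (simp add: Z_def)

  have "complex_of_real (odot U U) = of_real (p * q)" "complex_of_real (odot W W) = of_real (q * p)"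
    unfolding of_real_odot_self UVW of_real_mult using r5 by (simp_all add: ac_simps)
  then have UU: "odot U U = p * q" and WW: "odot W W = q * p"
    unfolding of_real_eq_iff by simp_all
  \<comment> \<open>The last coordinate of \<open>V\<close> is \<open>cnj C\<close>, so the fourth
    coordinate of the octonion equation is the conjugate of \<open>r8\<close>.\<close>
  have "complex_of_real p * cnj C = - (of_real u * (cnj A + cnj B) + K * (A - B))"
    using arg_cong[OF r8, of cnj] by simp
  with r6 r7 r8 have WU: "ocnj (omul W U) = oscale p V"
    by (simp add: UVW oct_defs oscale_def algebra_simps)
  have XOP: "X z \<in> OP2" if "z \<in> Z" for z
    unfolding X_def using p tr UU WW WU Z[OF that]
    by (intro hmat_in_OP2) (simp_all add: odot_twist_same twist_omul ocnj_twist oscale_twist)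
  \<comment> \<open>The corner entry \<open>x * x\<close> must be nonzero for
    \<open>hmat_in_OP2\<close>; \<open>x = 0\<close> would turn \<open>f4\<close> into 1/4 =
    7/23.\<close>
  have x0: "x \<noteq> 0"
  proof
    assume "x = 0"
    then have "y * y = 1 / 2" using f3 by simp
    with \<open>x = 0\<close> f4 show False by (simp add: power2_eq_square)
  qed
  then have X0OP: "X0 \<in> OP2"
    unfolding X0_def using f3 
    by (intro hmat_in_OP2) (simp_all add: odot_oscale omul_oscale_left oscale_oscale ac_simps,
        simp_all add: odot_def oone_def)

  have XX: "minner (X z) (X z') = 7 / 23" if "z \<in> Z" "z' \<in> Z" "z \<noteq> z'" for z z'
  proof -
    define t where "t = z * cnj z'"
    have t7: "t ^ 7 = 1"
    proof -
      have "cnj z' ^ 7 = 1" using that(2) by (simp add: Z_def flip: complex_cnj_power)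
      then show ?thesis using that(1) by (simp add: t_def Z_def power_mult_distrib)
    qed
    have "t \<noteq> 1"
    proof
      assume "t = 1"
      then have "z * (z' * cnj z') = z'" by (simp add: t_def ac_simps)
      then show False using Z[OF that(2)] that(3) by simp
    qed
    with t7 have per: "Re (t + t ^ 2 + t ^ 4) = - 1 / 2" by (rule Re_gauss_period)
    \<comment> \<open>The weights give exponents 1, 2, 3 and the Gauss period 1, 2, 4;
      \<open>t ^ 3\<close> and \<open>t ^ 4\<close> are conjugate.\<close>
    have "t ^ 3 = t ^ 3 * (t * cnj t) ^ 4"
      using seventh_root_of_unity[OF t7] by simp
    also have "\<dots> = t ^ 7 * cnj t ^ 4" by (simp add: power_mult_distrib flip: power_add mult.assoc)
    finally have t3: "Re (t ^ 3) = Re (t ^ 4)" using t7 by (simp flip: complex_cnj_power)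
    have "odot (twist z U) (twist z' U) + odot (twist z V) (twist z' V) + odot (twist z W) (twist z' W)
      = Re (of_real (2 * (u * u) + v * v) + t * (2 * (K * cnj K) + N * cnj N)
        + t ^ 2 * (A * cnj A + B * cnj B + C * cnj C) + t ^ 3 * (A * cnj A + B * cnj B + C * cnj C))"
      unfolding odot_twist t_def[symmetric] plus_complex.sel(1)[symmetric]
      by (rule arg_cong[where f = Re]) (simp add: UVW algebra_simps)
    \<comment> \<open>The three nontrivial coefficients agree. Doubling their contribution -8/161
      leaves 65/161 - 16/161 = 7/23.\<close>
    also have "\<dots> = 2 * (u * u) + v * v + 16 / 161 * Re (t + t ^ 2 + t ^ 3)"
      unfolding r1 r3 by simp
    also have "Re (t + t ^ 2 + t ^ 3) = - 1 / 2"
      using per t3 by simp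
    finally show ?thesis
      unfolding X_def minner_hmat using f1 by simp
  qed
  have XT: "minner (X z) (cycshift (X z')) = 7 / 23" for z z'
  proof -
    define t where "t = z * cnj z'"
    \<comment> \<open>All coefficients of positive powers of \<open>t\<close> vanish by
      \<open>r2\<close> and \<open>r4\<close>, so the value does not depend on \<open>z\<close> and
      \<open>z'\<close>.\<close>
    have "odot (twist z U) (twist z' V) + odot (twist z V) (twist z' W) + odot (twist z W) (twist z' U)
      = Re (of_real (2 * u * v + u * u) + t * (K * cnj N + N * cnj K + K * cnj K)
        + t ^ 2 * (A * cnj C + C * cnj B + B * cnj A) + t ^ 3 * (A * cnj C + C * cnj B + B * cnj A))"
      unfolding odot_twist t_def[symmetric] plus_complex.sel(1)[symmetric]
      by (rule arg_cong[where f = Re]) (simp add: UVW algebra_simps)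
    also have "\<dots> = 2 * u * v + u * u"
      unfolding r2 r4 by simp
    finally show ?thesis
      unfolding X_def cycshift_hmat minner_hmat using f2 by simp
  qed
  \<comment> \<open>\<open>X0\<close> has real entries, so only the real coordinates
    \<open>u\<close> and \<open>v\<close> of \<open>X z\<close> contribute, whatever
    \<open>z\<close> is.\<close>
  have X0X: "minner X0 (X z) = 7 / 23" "minner X0 (cycshift (X z)) = 7 / 23"
    "minner (X z) (cycshift X0) = 7 / 23" for z
    unfolding X0_def X_def cycshift_hmat minner_hmat odot_real_twist
    using f5 f6 by (simp_all add: UVW algebra_simps)
  have X0T: "minner X0 (cycshift X0) = 7 / 23"
    unfolding X0_def cycshift_hmat minner_hmat odot_oscale
    using f4 by (simp add: odot_def oone_def power2_eq_square algebra_simps)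

  have injX: "inj_on X Z"
  proof (rule inj_onI, rule ccontr)
    fix z z' assume "z \<in> Z" "z' \<in> Z" "X z = X z'" "z \<noteq> z'"
    then show False using XX[of z z'] minner_self[OF XOP[of z]] by simp
  qed
  have "X0 \<notin> X ` Z"
  proof
    assume "X0 \<in> X ` Z"
    then obtain z where "X0 = X z" by blast
    then show False using X0X(1)[of z] minner_self[OF X0OP] by simp
  qed
  moreover have "card Z = 7"
    unfolding Z_def by (rule card_roots_unity_eq) simp
  moreover from this have "finite Z"
    using card.infinite by fastforce
  ultimately have "card (insert X0 (X ` Z)) = 8"
    using injX by (simp add: card_image)
  moreover have "insert X0 (X ` Z) \<subseteq> OP2"
    using XOP X0OP by blast
  moreover have "minner P (cycshift Q) = 7 / 23"
    if "P \<in> insert X0 (X ` Z)" "Q \<in> insert X0 (X ` Z)" for P Q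
    using that XT X0X X0T by auto
  moreover have "minner P Q = 7 / 23"
    if "P \<in> insert X0 (X ` Z)" "Q \<in> insert X0 (X ` Z)" "P \<noteq> Q" for P Q
  proof -
    have "minner (X z) X0 = 7 / 23" for z
      using X0X(1) minner_commute by metis
    then show ?thesis
      using that XX X0X(1) by blast
  qed
  ultimately show ?thesis
    by (intro cyclic_tight_simplex)
qed

end
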